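(* Let $S:\mathbb{R}^n\rightrightarrows\mathbb{R}^m$ be a set-valued mapping, let $X\subseteq\mathbb{R}^n$ be closed with $\bar{x}\in X$, and let $\bar{u}\in S(\bar{x})$. Suppose that $\operatorname{gph}S$ is locally closed at $(\bar{x},\bar{u})$ and that $X$ is a smooth manifold around $\bar{x}$. Then the following properties hold for all $(x,u)$ close enough to $(\bar{x},\bar{u})$ in $\operatorname{gph}S|_X$: (a) $\operatorname{proj}_{T_X(x)\times\mathbb{R}^m}\widehat{N}_{\operatorname{gph}S|_X}(x,u)=\widehat{N}_{\operatorname{gph}S|_X}(x,u)\cap\left(T_X(x)\times\mathbb{R}^m\right)$. (b) $\operatorname{proj}_{T_X(x)\times\mathbb{R}^m}N_{\operatorname{gph}S|_X}(x,u)=N_{\operatorname{gph}S|_X}(x,u)\cap\left(T_X(x)\times\mathbb{R}^m\right)$. (c) $D^*_XS(x\mid u)(u^* )=\operatorname{proj}_{T_X(x)}D^*S|_X(x\mid u)(u^* )=D^*S|_X(x\mid u)(u^* )\cap T_X(x)$ for all $u^*\in\mathbb{R}^m$.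
   Context: For $C\subseteq\mathbb{R}^n$ and $x\in C$: $T_C(x)=\limsup_{t\searrow 0}\frac{C-x}{t}$ (outer limit) is the tangent (contingent) cone; the regular normal cone is $\widehat{N}_C(x)=\{v\mid \limsup_{x'\to x,\,x'\in C,\,x'\neq x}\langle v,x'-x\rangle/\|x'-x\|\le 0\}$; the limiting normal cone $N_C(x)$ is the set of $v$ for which there are $x_k\to x$, $x_k\in C$, and $v_k\to v$ with $v_k\in\widehat{N}_C(x_k)$. All three sets are empty for $x\notin C$. $C$ is locally closed at $x\in C$ if $C\cap U$ is closed for some closed neighborhood $U$ of $x$. $\operatorname{proj}_C(x)=\{y\in C\mid\|y-x\|=d(x,C)\}$ and $\operatorname{proj}_CA=\bigcup_{a\in A}\operatorname{proj}_C(a)$. For $S:\mathbb{R}^n\rightrightarrows\mathbb{R}^m$, $\operatorname{gph}S=\{(x,u)\mid u\in S(x)\}$; $S|_X$ equals $S(x)$ for $x\in X$ and $\emptyset$ for $x\notin X$. The coderivative $D^*S(\bar{x}\mid\bar{u}):\mathbb{R}^m\rightrightarrows\mathbb{R}^n$ is defined by $x^*\in D^*S(\bar{x}\mid\bar{u})(u^* )\iff(x^*,-u^* )\in N_{\operatorname{gph}S}(\bar{x},\bar{u})$. The projectional coderivative $D^*_XS(\bar{x}\mid\bar{u}):\mathbb{R}^m\rightrightarrows\mathbb{R}^n$ of $S$ at $\bar{x}\in X$ for $\bar{u}\in S(\bar{x})$ with respect to $X$ is defined by $$t^*\in D^*_XS(\bar{x}\mid\bar{u})(u^* )\iff(t^*,-u^*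 )\in\limsup_{(x,u)\to(\bar{x},\bar{u}),\,(x,u)\in\operatorname{gph}S|_X}\operatorname{proj}_{T_X(x)\times\mathbb{R}^m}N_{\operatorname{gph}S|_X}(x,u),$$ where $\limsup$ is the (Painlevé–Kuratowski) outer limit of sets. $X$ is a ($d$-dimensional) smooth manifold around $\bar{x}\in X$ if there are an open neighborhood $O$ of $\bar{x}$ and a $\mathcal{C}^1$ mapping $F:O\to\mathbb{R}^{n-d}$ with $\nabla F(\bar{x})$ of full rank $n-d$ such that $X\cap O=\{x\in O\mid F(x)=0\}$. *)

theory Defs
  imports "HOL-Analysis.Analysis"
begin

(* Painleve-Kuratowski outer limit of S(x) as x tends to a within D.
   The approximating sequence may visit a itself whenever a lies in D. *)
definition outer_limit ::
  "('a::topological_space \<Rightarrow> 'b::topological_space set) \<Rightarrow> 'a set \<Rightarrow> 'a \<Rightarrow> 'b set"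
where
  "outer_limit S D a =
    {v. \<exists>x w. (\<forall>k::nat. x k \<in> D \<and> w k \<in> S (x k)) \<and> x \<longlonglongrightarrow> a \<and> w \<longlonglongrightarrow> v}"

definition tangent_cone :: "'a::euclidean_space set \<Rightarrow> 'a \<Rightarrow> 'a set"
where
  "tangent_cone C x =
    (if x \<in> C then outer_limit (\<lambda>t::real. (\<lambda>c. (c - x) /\<^sub>R t) ` C) {0<..} 0 else {})"

(* At an isolated point x of C the filter is bot and the Limsup is -\<infinity>,
   so every vector is a regular normal there. *)
definition regular_normal_cone :: "'a::euclidean_space set \<Rightarrow> 'a \<Rightarrow> 'a set"
where
  "regular_normal_cone C x =
    (if x \<in> C
     then {v. Limsup (at x within C) (\<lambda>x'. ereal (v \<bullet> (x' - x) / norm (x' - x))) \<le> 0}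
     else {})"

definition normal_cone :: "'a::euclidean_space set \<Rightarrow> 'a \<Rightarrow> 'a set"
where
  "normal_cone C x = (if x \<in> C then outer_limit (regular_normal_cone C) C x else {})"

definition locally_closed_at :: "'a::topological_space set \<Rightarrow> 'a \<Rightarrow> bool"
where
  "locally_closed_at C x \<longleftrightarrow>
    x \<in> C \<and> (\<exists>U. closed U \<and> x \<in> interior U \<and> closed (C \<inter> U))"

definition proj :: "'a::metric_space set \<Rightarrow> 'a \<Rightarrow> 'a set"
where
  "proj C x = {y \<in> C. dist y x = infdist x C}"

definition proj_set :: "'a::metric_space set \<Rightarrow> 'a set \<Rightarrow> 'a set"
where
  "proj_set C A = (\<Union>a\<in>A. proj C a)"

definition gph :: "('a \<Rightarrow> 'b set) \<Rightarrow> ('a \<times> 'b) set"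
where
  "gph S = {(x, u). u \<in> S x}"

definition restrict_svm :: "('a \<Rightarrow> 'b set) \<Rightarrow> 'a set \<Rightarrow> 'a \<Rightarrow> 'b set"
where
  "restrict_svm S X x = (if x \<in> X then S x else {})"

definition coderivative ::
  "('a::euclidean_space \<Rightarrow> 'b::euclidean_space set) \<Rightarrow> 'a \<Rightarrow> 'b \<Rightarrow> 'b \<Rightarrow> 'a set"
where
  "coderivative S x u us = {xs. (xs, - us) \<in> normal_cone (gph S) (x, u)}"

definition proj_coderivative ::
  "'a::euclidean_space set \<Rightarrow> ('a \<Rightarrow> 'b::euclidean_space set) \<Rightarrow> 'a \<Rightarrow> 'b \<Rightarrow> 'b \<Rightarrow> 'a set"
where
  "proj_coderivative X S x u us =
    {ts. (ts, - us) \<in>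
      outer_limit
        (\<lambda>p. proj_set (tangent_cone X (fst p) \<times> UNIV)
               (normal_cone (gph (restrict_svm S X)) p))
        (gph (restrict_svm S X)) (x, u)}"

(* With n = DIM('a), the mapping into an (n - d)-dimensional space is given by its
   components F i, i < n - d; G i is the gradient of F i. The rank of the Jacobian
   at x is the dimension of the span of its rows G i x. *)
definition smooth_manifold_around :: "nat \<Rightarrow> 'a::euclidean_space set \<Rightarrow> 'a \<Rightarrow> bool"
where
  "smooth_manifold_around d X x \<longleftrightarrow>
    d \<le> DIM('a) \<and> x \<in> X \<and>
    (\<exists>U (F :: nat \<Rightarrow> 'a \<Rightarrow> real) (G :: nat \<Rightarrow> 'a \<Rightarrow> 'a).
      open U \<and> x \<in> U \<and>
      (\<forall>i < DIM('a) - d. (\<forall>y\<in>U. GDERIV (F i) y :> G i y) \<and> continuous_on U (G i)) \<and>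
      dim ((\<lambda>i. G i x) ` {..< DIM('a) - d}) = DIM('a) - d \<and>
      X \<inter> U = {y \<in> U. \<forall>i < DIM('a) - d. F i y = 0})"

end

theory Submission
  imports Defs
begin

text \<open>
  Near the base point let \<open>X\<close> be the common zero set of functions \<open>F i\<close> with gradients \<open>G i\<close>,
  and let \<open>C\<close> be the graph of \<open>S\<close> restricted to \<open>X\<close>.

  The gradient of a function that vanishes on a set is a regular normal to that set, and so is its
  negative.  Since \<open>C\<close> lies over \<open>X\<close>, every vector \<open>c *\<^sub>R (G i x, 0)\<close> is therefore a
  regular normal to \<open>C\<close> at \<open>(x, u)\<close>, and adding it maps the regular normal cone into itself
  (\<open>regular_normal_cone_add_gradient\<close>).  The gradients are continuous, so this invariance passes
  to the limit and holds for the limiting normal cone as well (\<open>normal_cone_add_gradient\<close>).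

  On the other hand the tangent cone of \<open>X\<close> at every \<open>x\<close> near the base point is the
  orthogonal complement of the gradients \<open>G i x\<close> (\<open>tangent_cone_eq_kernel_near\<close>).  One
  inclusion is the polarity of tangents and regular normals; for the other, the inverse function
  theorem yields a single local diffeomorphism that straightens \<open>X\<close> into a linear subspace, and
  pulling straight lines back gives curves in \<open>X\<close> with every prescribed velocity.

  Projecting onto the complement of the gradients subtracts a vector from their span.  A set that is
  invariant under adding multiples of the gradients contains the result, so its projection is its
  intersection with the subspace (\<open>proj_set_eq_Int_if_lineality\<close>).  This gives (a), (b) and the
  second equation of (c).  By (b) the projectional coderivative is an outer limit of intersections
  of normal cones with tangent spaces.  Both depend outer semicontinuously on the point: the normal
  cone because outer limits can be iterated (\<open>outer_limit_outer_limit_subset\<close>), the tangent space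
  because it is cut out by continuous equations.  Hence the outer limit is the
  intersection at the point itself, which is the first equation of (c).
\<close>

section \<open>Outer limits\<close>

text \<open>The approximating sequences may be taken inside any neighborhood of the limit point; since the
  definition constrains every index, an initial segment has to be dropped.\<close>

lemma outer_limit_localE:
  assumes "v \<in> outer_limit S D a" "open W" "a \<in> W"
  obtains x w where "\<And>k. x k \<in> D" "\<And>k. x k \<in> W" "\<And>k::nat. w k \<in> S (x k)"
    "x \<longlonglongrightarrow> a" "w \<longlonglongrightarrow> v"
proof -
  obtain x w where xw: "\<And>k. x k \<in> D" "\<And>k::nat. w k \<in> S (x k)" "x \<longlonglongrightarrow> a" "w \<longlonglongrightarrow> v"
    using assms(1) unfolding outer_limit_def by blast
  obtain N where N: "\<And>k. k \<ge> N \<Longrightarrow> x k \<in> W"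
    using topological_tendstoD[OF xw(3) assms(2,3)] unfolding eventually_sequentially by blast
  show thesis
    by (rule that[of "\<lambda>k. x (k + N)" "\<lambda>k. w (k + N)"])
       (use xw N in \<open>auto intro: LIMSEQ_ignore_initial_segment\<close>)
qed

lemma outer_limitI:
  assumes "\<And>k. x k \<in> D" "\<And>k::nat. w k \<in> S (x k)" "x \<longlonglongrightarrow> a" "w \<longlonglongrightarrow> v"
  shows "v \<in> outer_limit S D a"
  using assms unfolding outer_limit_def by blast

lemma outer_limit_constI:
  assumes "a \<in> D" "v \<in> S a"
  shows "v \<in> outer_limit S D a"
  by (rule outer_limitI[of "\<lambda>_. a" _ "\<lambda>_. v"]) (use assms in auto)

lemma tendsto_if_dist_less_inverse_Suc:
  assumes "x \<longlonglongrightarrow> a" "\<And>k. dist (y k) (x k) < 1 / real (Suc k)"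
  shows "y \<longlonglongrightarrow> a"
proof -
  have "(\<lambda>k. inverse (real (Suc k)) + dist (x k) a) \<longlonglongrightarrow> 0 + dist a a"
    by (intro tendsto_intros LIMSEQ_inverse_real_of_nat assms)
  then have lim: "(\<lambda>k. inverse (real (Suc k)) + dist (x k) a) \<longlonglongrightarrow> 0" by simp
  have "dist (y k) a \<le> inverse (real (Suc k)) + dist (x k) a" for k
    using dist_triangle[of "y k" a "x k"] assms(2)[of k] by (simp add: inverse_eq_divide)
  then have "(\<lambda>k. dist (y k) a) \<longlonglongrightarrow> 0"
    by (intro Lim_null_comparison[OF _ lim] always_eventually) simp
  then show ?thesis by (rule tendsto_dist_iff[THEN iffD2])
qed

text \<open>A diagonal argument: each approximating value is itself approximated up to
  \<open>1 / Suc k\<close>.  This is the reason why limiting normal cones are outer semicontinuous.\<close>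

lemma outer_limit_outer_limit_subset:
  fixes S :: "'a::metric_space \<Rightarrow> 'b::metric_space set"
  shows "outer_limit (outer_limit S D) D a \<subseteq> outer_limit S D a"
proof
  fix v assume "v \<in> outer_limit (outer_limit S D) D a"
  then obtain x w where xw: "\<And>k. x k \<in> D" "\<And>k::nat. w k \<in> outer_limit S D (x k)"
    and lim: "x \<longlonglongrightarrow> a" "w \<longlonglongrightarrow> v"
    unfolding outer_limit_def by blast
  have "\<exists>y z. y \<in> D \<and> z \<in> S y \<and> dist y (x k) < 1 / real (Suc k) \<and> dist z (w k) < 1 / real (Suc k)"
    for k
  proof -
    obtain y z where yz: "\<And>j. y j \<in> D" "\<And>j::nat. z j \<in> S (y j)" "y \<longlonglongrightarrow> x k" "z \<longlonglongrightarrow> w k"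
      using xw(2)[of k] unfolding outer_limit_def by blast
    have "\<forall>\<^sub>F j in sequentially. dist (y j) (x k) < 1 / real (Suc k) \<and> dist (z j) (w k) < 1 / real (Suc k)"
      using tendstoD[OF yz(3), of "1 / real (Suc k)"] tendstoD[OF yz(4), of "1 / real (Suc k)"]
      by (auto intro: eventually_conj)
    then obtain j where "dist (y j) (x k) < 1 / real (Suc k) \<and> dist (z j) (w k) < 1 / real (Suc k)"
      unfolding eventually_sequentially by blast
    then show ?thesis using yz(1,2) by blast
  qed
  then obtain y z where yz: "\<And>k. y k \<in> D" "\<And>k. z k \<in> S (y k)"
    "\<And>k. dist (y k) (x k) < 1 / real (Suc k)" "\<And>k. dist (z k) (w k) < 1 / real (Suc k)"
    by metis
  have "y \<longlonglongrightarrow> a" "z \<longlonglongrightarrow> v"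
    using tendsto_if_dist_less_inverse_Suc yz(3,4) lim by blast+
  show "v \<in> outer_limit S D a"
    by (rule outer_limitI[of y _ z]) fact+
qed

section \<open>Normal cones\<close>

lemma Limsup_ereal_le_0_iff:
  "Limsup F (\<lambda>y. ereal (q y)) \<le> 0 \<longleftrightarrow> (\<forall>e>0. \<forall>\<^sub>F y in F. q y < e)"
proof
  assume *: "Limsup F (\<lambda>y. ereal (q y)) \<le> 0"
  show "\<forall>e>0. \<forall>\<^sub>F y in F. q y < e"
  proof (intro allI impI)
    fix e :: real assume "e > 0"
    then have "ereal e > 0" by simp
    then have "\<forall>\<^sub>F y in F. ereal (q y) < ereal e"
      using *[unfolded Limsup_le_iff, rule_format, of "ereal e"] by blast
    then show "\<forall>\<^sub>F y in F. q y < e" by simp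
  qed
next
  assume *: "\<forall>e>0. \<forall>\<^sub>F y in F. q y < e"
  show "Limsup F (\<lambda>y. ereal (q y)) \<le> 0"
    unfolding Limsup_le_iff
  proof (intro allI impI)
    fix z :: ereal assume "0 < z"
    then obtain e where e: "0 < ereal e" "ereal e < z"
      using ereal_dense2 by blast
    then have "\<forall>\<^sub>F y in F. q y < e" using * by simp
    then show "\<forall>\<^sub>F y in F. ereal (q y) < z"
      by eventually_elim (rule less_trans[OF _ e(2)], simp)
  qed
qed

text \<open>Multiplying out the quotient allows the point \<open>x\<close> itself, so that punctured neighborhoods can
  be replaced by full ones.\<close>

lemma eventually_quotient_less_iff:
  fixes x :: "'a::real_normed_vector"
  assumes "f x = 0"
  shows "(\<forall>e>0. \<forall>\<^sub>F y in at x within C. f y / norm (y - x) < e) \<longleftrightarrow>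
    (\<forall>e>0. \<forall>\<^sub>F y in nhds x. y \<in> C \<longrightarrow> f y \<le> e * norm (y - x))"
proof (intro iffI allI impI)
  fix e :: real assume *: "\<forall>e>0. \<forall>\<^sub>F y in at x within C. f y / norm (y - x) < e" "e > 0"
  then have "\<forall>\<^sub>F y in nhds x. y \<noteq> x \<longrightarrow> y \<in> C \<longrightarrow> f y / norm (y - x) < e"
    unfolding eventually_at_filter by blast
  then show "\<forall>\<^sub>F y in nhds x. y \<in> C \<longrightarrow> f y \<le> e * norm (y - x)"
  proof eventually_elim
    case (elim y)
    then show ?case by (cases "y = x") (auto simp: assms divide_less_eq)
  qed
next
  fix e :: real
  assume *: "\<forall>e>0. \<forall>\<^sub>F y in nhds x. y \<in> C \<longrightarrow> f y \<le> e * norm (y - x)" and e: "e > 0"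
  have "\<forall>\<^sub>F y in nhds x. y \<in> C \<longrightarrow> f y \<le> (e/2) * norm (y - x)"
    using *[rule_format, of "e/2"] e by simp
  then have "\<forall>\<^sub>F y in nhds x. y \<noteq> x \<longrightarrow> y \<in> C \<longrightarrow> f y / norm (y - x) < e"
  proof eventually_elim
    case (elim y)
    show ?case
    proof (intro impI)
      assume y: "y \<noteq> x" "y \<in> C"
      have "f y / norm (y - x) \<le> e/2" using y elim by (simp add: divide_le_eq)
      moreover have "e/2 < e" using e by simp
      ultimately show "f y / norm (y - x) < e" by (rule le_less_trans)
    qed
  qed
  then show "\<forall>\<^sub>F y in at x within C. f y / norm (y - x) < e" unfolding eventually_at_filter .
qed

text \<open>The working form of regular normality: \<open>v \<bullet> (y - x) \<le> o(norm (y - x))\<close> on \<open>C\<close>.  Sums of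
  normals are then handled pointwise.\<close>

lemma mem_regular_normal_cone_iff:
  "v \<in> regular_normal_cone C x \<longleftrightarrow>
    x \<in> C \<and> (\<forall>e>0. \<forall>\<^sub>F y in nhds x. y \<in> C \<longrightarrow> v \<bullet> (y - x) \<le> e * norm (y - x))"
  unfolding regular_normal_cone_def
    eventually_quotient_less_iff[of "\<lambda>y. v \<bullet> (y - x)" x C, simplified, symmetric] Limsup_ereal_le_0_iff[symmetric]
  by simp

lemma regular_normal_cone_add:
  assumes "v \<in> regular_normal_cone C x" "w \<in> regular_normal_cone C x"
  shows "v + w \<in> regular_normal_cone C x"
  unfolding mem_regular_normal_cone_iff
proof (intro conjI allI impI)
  show "x \<in> C" using assms(1) by (simp add: mem_regular_normal_cone_iff)
  fix e :: real assume "e > 0"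
  then have e: "e / 2 > 0" by simp
  have "\<forall>\<^sub>F y in nhds x. y \<in> C \<longrightarrow> v \<bullet> (y - x) \<le> e/2 * norm (y - x)"
       "\<forall>\<^sub>F y in nhds x. y \<in> C \<longrightarrow> w \<bullet> (y - x) \<le> e/2 * norm (y - x)"
    using assms e unfolding mem_regular_normal_cone_iff by blast+
  then show "\<forall>\<^sub>F y in nhds x. y \<in> C \<longrightarrow> (v + w) \<bullet> (y - x) \<le> e * norm (y - x)"
    by eventually_elim (auto simp: inner_add_left)
qed

text \<open>Both \<open>f y\<close> and \<open>f x\<close> vanish for \<open>y\<close> in \<open>C\<close> near \<open>x\<close>, so the linear part
  of the increment is of the order of the remainder.\<close>

lemma gradient_in_regular_normal_cone:
  assumes "GDERIV f x :> g" "open U" "x \<in> C" "x \<in> U" "\<And>y. y \<in> C \<inter> U \<Longrightarrow> f y = 0"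
  shows "g \<in> regular_normal_cone C x"
  unfolding mem_regular_normal_cone_iff
proof (intro conjI allI impI)
  fix e :: real assume "e > 0"
  then obtain r where r: "r > 0"
    "\<And>y. norm (y - x) < r \<Longrightarrow> norm (f y - f x - (y - x) \<bullet> g) \<le> e * norm (y - x)"
    using assms(1) unfolding gderiv_def has_derivative_at_alt by blast
  have "\<forall>\<^sub>F y in nhds x. y \<in> U" "\<forall>\<^sub>F y in nhds x. dist y x < r"
    using assms r(1) by (auto intro: eventually_nhds_in_open eventually_nhds_metric[THEN iffD2])
  then show "\<forall>\<^sub>F y in nhds x. y \<in> C \<longrightarrow> g \<bullet> (y - x) \<le> e * norm (y - x)"
  proof eventually_elim
    case (elim y)
    show ?case
    proof
      assume "y \<in> C"
      then have "f y = 0" "f x = 0" using elim assms by auto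
      then show "g \<bullet> (y - x) \<le> e * norm (y - x)"
        using r(2)[of y] elim by (auto simp: dist_norm inner_commute)
    qed
  qed
qed (use assms in auto)

lemma regular_normal_cone_polar:
  assumes "v \<in> regular_normal_cone C x" "w \<in> tangent_cone C x"
  shows "v \<bullet> w \<le> 0"
proof -
  have x: "x \<in> C" using assms(2) by (auto simp: tangent_cone_def split: if_splits)
  then obtain t s where ts: "\<And>k. t k > 0" "\<And>k::nat. s k \<in> (\<lambda>c. (c - x) /\<^sub>R t k) ` C"
    "t \<longlonglongrightarrow> (0::real)" "s \<longlonglongrightarrow> w"
    using assms(2) unfolding tangent_cone_def outer_limit_def by auto
  have C: "x + t k *\<^sub>R s k \<in> C" for k
  proof -
    obtain c where "c \<in> C" "s k = (c - x) /\<^sub>R t k" using ts(2)[of k] by blast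
    then show ?thesis using ts(1)[of k] by simp
  qed
  have "(\<lambda>k. x + t k *\<^sub>R s k) \<longlonglongrightarrow> x + 0 *\<^sub>R w"
    by (intro tendsto_intros ts)
  then have lim: "(\<lambda>k. x + t k *\<^sub>R s k) \<longlonglongrightarrow> x" by simp
  have "v \<bullet> w \<le> e * norm w" if "e > 0" for e
  proof -
    have "\<forall>\<^sub>F y in nhds x. y \<in> C \<longrightarrow> v \<bullet> (y - x) \<le> e * norm (y - x)"
      using assms(1) that unfolding mem_regular_normal_cone_iff by blast
    then have "\<forall>\<^sub>F k in sequentially. v \<bullet> s k \<le> e * norm (s k)"
      using filterlim_iff[THEN iffD1, OF lim] C ts(1)
      by (auto elim!: allE eventually_mono simp: less_imp_le abs_of_pos mult.left_commute)
    then show ?thesis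
      by (intro tendsto_le[OF _ _ _ ]) (auto intro!: tendsto_intros ts)
  qed
  then have "v \<bullet> w \<le> 0 + e" if "e > 0" for e :: real
  proof -
    have "v \<bullet> w \<le> (e / (norm w + 1)) * norm w"
      by (rule \<open>\<And>e. e > 0 \<Longrightarrow> v \<bullet> w \<le> e * norm w\<close>) (use that in \<open>simp add: add_nonneg_pos\<close>)
    also have "\<dots> = e * (norm w / (norm w + 1))" by simp
    also have "\<dots> \<le> e"
      using that by (intro mult_left_le) (simp_all add: divide_le_eq add_nonneg_pos)
    finally show ?thesis by simp
  qed
  then show ?thesis by (rule field_le_epsilon)
qed

lemma outer_limit_normal_cone_subset:
  assumes "x \<in> C"
  shows "outer_limit (normal_cone C) C x \<subseteq> normal_cone C x"
proof -
  have "outer_limit (normal_cone C) C x = outer_limit (outer_limit (regular_normal_cone C) C) C x"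
    unfolding outer_limit_def[of "normal_cone C"] outer_limit_def[of "outer_limit _ _"]
    by (auto simp: normal_cone_def)
  then show ?thesis
    using outer_limit_outer_limit_subset assms by (metis normal_cone_def)
qed

section \<open>Projection onto a subspace\<close>

lemma proj_orthogonal_complement:
  fixes v :: "'a::euclidean_space"
  assumes z: "\<And>b. b \<in> B \<Longrightarrow> b \<bullet> z = 0" and vz: "v - z \<in> span B"
  shows "proj {w. \<forall>b\<in>B. b \<bullet> w = 0} v = {z}"
proof -
  let ?T = "{w. \<forall>b\<in>B. b \<bullet> w = 0}"
  have orth: "(v - z) \<bullet> w = 0" if "w \<in> ?T" for w
    using vz
  proof (induction rule: span_induct)
    case base
    show ?case using that by (auto simp: subspace_def inner_add_left)
  qed (use that in auto)
  have pyth: "(dist w v)\<^sup>2 = (dist z v)\<^sup>2 + (dist w z)\<^sup>2" if "w \<in> ?T" for w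
  proof -
    have "orthogonal (w - z) (z - v)"
      using orth[of w] orth[of z] that z
      by (auto simp: orthogonal_def inner_diff_left inner_diff_right inner_commute)
    from norm_add_Pythagorean[OF this] show ?thesis by (simp add: dist_norm)
  qed
  have zT: "z \<in> ?T" using z by blast
  have le: "dist z v \<le> dist w v" if "w \<in> ?T" for w
    by (rule power2_le_imp_le) (simp_all add: pyth[OF that])
  have inf: "infdist v ?T = dist z v"
  proof (rule antisym)
    show "infdist v ?T \<le> dist z v" using infdist_le[OF zT, of v] by (simp add: dist_commute)
    show "dist z v \<le> infdist v ?T"
    proof -
      have ne: "?T \<noteq> {}" using zT by blast
      show ?thesis unfolding infdist_notempty[OF ne]
      proof (rule cINF_greatest[OF ne])
        fix w assume "w \<in> ?T"
        then show "dist z v \<le> dist v w" using le by (simp add: dist_commute[of v])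
      qed
    qed
  qed
  have "w = z" if "w \<in> ?T" "dist w v = dist z v" for w
    using pyth[OF that(1)] that(2) by simp
  then show ?thesis unfolding proj_def inf using zT by (intro equalityI subsetI) simp_all
qed

text \<open>If every \<open>b\<close> in \<open>B\<close> spans a line of directions along which \<open>N\<close> is invariant, then so does every
  vector of \<open>span B\<close>, because such directions form a subspace.  The projection of \<open>v\<close> onto the
  complement of \<open>B\<close> differs from \<open>v\<close> by such a vector, so it stays in \<open>N\<close>.\<close>

lemma proj_set_eq_Int_if_lineality:
  fixes N :: "'a::euclidean_space set"
  assumes shift: "\<And>b v c. b \<in> B \<Longrightarrow> v \<in> N \<Longrightarrow> v + c *\<^sub>R b \<in> N"
  shows "proj_set {w. \<forall>b\<in>B. b \<bullet> w = 0} N = N \<inter> {w. \<forall>b\<in>B. b \<bullet> w = 0}"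
proof -
  let ?T = "{w. \<forall>b\<in>B. b \<bullet> w = 0}"
  have span_shift: "\<forall>v\<in>N. \<forall>c. v + c *\<^sub>R l \<in> N" if "l \<in> span B" for l
    using that
  proof (induction rule: span_induct)
    case base
    show ?case unfolding subspace_def
      by (auto simp: scaleR_add_right add.assoc[symmetric])
  qed (use shift in auto)
  show ?thesis
  proof
    show "proj_set ?T N \<subseteq> N \<inter> ?T"
    proof
      fix z assume "z \<in> proj_set ?T N"
      then obtain v where v: "v \<in> N" "z \<in> proj ?T v" by (auto simp: proj_set_def)
      obtain y p where yp: "y \<in> span B" "\<And>w. w \<in> span B \<Longrightarrow> orthogonal p w" "v = y + p"
        using orthogonal_subspace_decomp_exists by blast
      have p: "b \<bullet> p = 0" if "b \<in> B" for b
        using yp(2)[OF span_base[OF that]] by (simp add: orthogonal_def inner_commute)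
      have "proj ?T v = {p}"
        by (rule proj_orthogonal_complement) (use p yp in auto)
      then have "z = p" using v by simp
      have "v + (-1) *\<^sub>R y \<in> N" using span_shift[OF yp(1)] v(1) by blast
      then show "z \<in> N \<inter> ?T" using \<open>z = p\<close> p yp(3) by simp
    qed
    show "N \<inter> ?T \<subseteq> proj_set ?T N"
    proof
      fix z assume z: "z \<in> N \<inter> ?T"
      have "proj ?T z = {z}"
        by (rule proj_orthogonal_complement) (use z span_zero in auto)
      then show "z \<in> proj_set ?T N" using z by (auto simp: proj_set_def)
    qed
  qed
qed

section \<open>Tangent spaces of smooth manifolds\<close>

lemma curve_derivative_in_tangent_cone:
  assumes "(y has_vector_derivative w) (at 0)" "\<forall>\<^sub>F t in at_right 0. y t \<in> C" "y 0 \<in> C"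
  shows "w \<in> tangent_cone C (y 0)"
proof -
  obtain r where r: "r > 0" "\<And>t. 0 < t \<Longrightarrow> t < r \<Longrightarrow> y t \<in> C"
    using assms(2) unfolding eventually_at_right_field by auto
  \<comment> \<open>The shift by two keeps \<open>t 0\<close> strictly below \<open>r\<close>.\<close>
  define t where "t k = r * inverse (real (Suc (Suc k)))" for k
  have t0: "t k > 0" for k using r by (simp add: t_def)
  have tr: "t k < r" for k
    using mult_strict_left_mono[OF _ r(1), of "inverse (real (Suc (Suc k)))" 1]
    by (simp add: t_def inverse_eq_divide)
  have "(\<lambda>k. inverse (real (Suc (Suc k)))) \<longlonglongrightarrow> 0"
    using LIMSEQ_Suc[OF LIMSEQ_inverse_real_of_nat] .
  then have tlim: "t \<longlonglongrightarrow> 0"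
    unfolding t_def using tendsto_mult_right_zero by blast
  have "((\<lambda>t. (y t - y 0) /\<^sub>R t) \<longlongrightarrow> w) (at 0)"
  proof -
    have "((\<lambda>h. norm (y (0 + h) - y 0 - h *\<^sub>R w) / norm h) \<longlongrightarrow> 0) (at 0)"
      using assms(1) unfolding has_vector_derivative_def has_derivative_at by blast
    then have "((\<lambda>h. dist ((y h - y 0) /\<^sub>R h) w) \<longlongrightarrow> 0) (at 0)"
    proof (rule Lim_transform_eventually)
      have "norm (y (0 + h) - y 0 - h *\<^sub>R w) / norm h = dist ((y h - y 0) /\<^sub>R h) w"
        if "h \<noteq> 0" for h
      proof -
        have "(y h - y 0) /\<^sub>R h - w = (y h - y 0 - h *\<^sub>R w) /\<^sub>R h"
          using that by (simp add: scaleR_diff_right)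
        then show ?thesis by (simp add: dist_norm divide_inverse)
      qed
      then show "\<forall>\<^sub>F h in at 0. norm (y (0 + h) - y 0 - h *\<^sub>R w) / norm h
          = dist ((y h - y 0) /\<^sub>R h) w"
        by (simp add: eventually_at_filter)
    qed
    then show ?thesis by (rule tendsto_dist_iff[THEN iffD2])
  qed
  then have "(\<lambda>k. (y (t k) - y 0) /\<^sub>R t k) \<longlonglongrightarrow> w"
  proof (rule filterlim_compose)
    show "filterlim t (at 0) sequentially"
      using tlim t0[THEN less_imp_neq, symmetric] by (simp add: filterlim_at)
  qed
  moreover have "(y (t k) - y 0) /\<^sub>R t k \<in> (\<lambda>c. (c - y 0) /\<^sub>R t k) ` C" for k
    using r(2)[OF t0 tr] by blast
  ultimately show ?thesis
    unfolding tangent_cone_def if_P[OF assms(3)] using t0 tlim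
    by (intro outer_limitI[of t _ "\<lambda>k. (y (t k) - y 0) /\<^sub>R t k"]) auto
qed

text \<open>The dimension hypothesis says that the \<open>g i\<close> are pairwise distinct and linearly independent.
  The dual vectors represent the coordinate functionals.\<close>

lemma dual_family:
  fixes g :: "nat \<Rightarrow> 'a::euclidean_space"
  assumes "dim (g ` {..<m}) = m"
  obtains e where "\<And>i j. i < m \<Longrightarrow> j < m \<Longrightarrow> g i \<bullet> e j = (if i = j then 1 else 0)"
proof -
  let ?B = "g ` {..<m}"
  have "card ?B = m"
    using assms dim_le_card'[of ?B] card_image_le[of "{..<m}" g] by simp
  then have inj: "inj_on g {..<m}" by (simp add: eq_card_imp_inj_on)
  have ind: "independent ?B"
    using card_le_dim_spanning[of ?B ?B] \<open>card ?B = m\<close> assms by (auto simp: span_superset)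
  have "\<exists>e. \<forall>i<m. g i \<bullet> e = (if i = j then 1 else 0)" if "j < m" for j
  proof -
    obtain f :: "'a \<Rightarrow> real" where f: "linear f" "\<And>b. b \<in> ?B \<Longrightarrow> f b = (if b = g j then 1 else 0)"
      using linear_independent_extend[OF ind, of "\<lambda>b. if b = g j then 1 else 0"] by auto
    have "g i \<bullet> adjoint f 1 = (if i = j then 1 else 0)" if "i < m" for i
    proof -
      have "g i \<bullet> adjoint f 1 = f (g i)" using adjoint_works[OF f(1), of "g i" 1] by simp
      also have "\<dots> = (if i = j then 1 else 0)"
        using f(2)[of "g i"] that \<open>j < m\<close> inj by (auto dest: inj_onD)
      finally show ?thesis .
    qed
    then show ?thesis by blast
  qed
  then show thesis using that by metis
qed

text \<open>With \<open>e\<close> dual to the gradients at \<open>xbar\<close>, the map \<open>\<Phi>\<close> below satisfies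
  \<open>g i \<bullet> \<Phi> y = F i y\<close> and its derivative at \<open>xbar\<close> is the identity.  So it is a local
  diffeomorphism that carries \<open>X\<close> to the subspace orthogonal to the \<open>g i\<close>.  The same chart serves
  all points \<open>x\<close> near \<open>xbar\<close>, hence the linear independence of the gradients is used at \<open>xbar\<close>
  only.\<close>

lemma tangent_cone_eq_kernel_near:
  fixes F :: "nat \<Rightarrow> 'a::euclidean_space \<Rightarrow> real" and G :: "nat \<Rightarrow> 'a \<Rightarrow> 'a"
  assumes U: "open U" "xbar \<in> U"
    and der: "\<And>i y. i < m \<Longrightarrow> y \<in> U \<Longrightarrow> GDERIV (F i) y :> G i y"
    and cont: "\<And>i. i < m \<Longrightarrow> continuous_on U (G i)"
    and rank: "dim ((\<lambda>i. G i xbar) ` {..<m}) = m"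
    and X: "X \<inter> U = {y \<in> U. \<forall>i<m. F i y = 0}"
  obtains W where "open W" "xbar \<in> W" "W \<subseteq> U"
    "\<And>x. x \<in> X \<inter> W \<Longrightarrow> tangent_cone X x = {w. \<forall>i<m. G i x \<bullet> w = 0}"
proof -
  define g where "g i = G i xbar" for i
  obtain e where e: "\<And>i j. i < m \<Longrightarrow> j < m \<Longrightarrow> g i \<bullet> e j = (if i = j then 1 else 0)"
    using dual_family[of g m] rank unfolding g_def by blast
  define \<Phi> where "\<Phi> y = y + (\<Sum>j<m. (F j y - g j \<bullet> y) *\<^sub>R e j)" for y
  define \<Phi>' where "\<Phi>' y = id_blinfun +
    (\<Sum>j<m. blinfun_scaleR_left (e j) o\<^sub>L blinfun_inner_left (G j y - g j))" for y
  have apply_\<Phi>': "\<Phi>' y h = h + (\<Sum>j<m. (h \<bullet> (G j y - g j)) *\<^sub>R e j)" for y h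
    by (simp add: \<Phi>'_def blinfun.add_left blinfun.sum_left)
  have der_\<Phi>: "(\<Phi> has_derivative blinfun_apply (\<Phi>' y)) (at y)" if "y \<in> U" for y
  proof -
    have F: "(F j has_derivative (\<lambda>h. h \<bullet> G j y)) (at y)" if "j < m" for j
      using der[OF that \<open>y \<in> U\<close>] unfolding gderiv_def .
    have "(\<Phi> has_derivative (\<lambda>h. h + (\<Sum>j<m. (h \<bullet> G j y - g j \<bullet> h) *\<^sub>R e j))) (at y)"
      unfolding \<Phi>_def[abs_def] by (auto intro!: derivative_intros F)
    then show ?thesis
      by (rule has_derivative_eq_rhs) (auto simp: apply_\<Phi>' inner_diff_right inner_commute)
  qed
  have cont_\<Phi>': "continuous_on U \<Phi>'"
    unfolding \<Phi>'_def[abs_def]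
    by (intro continuous_intros bounded_linear.continuous_on[OF bounded_linear_blinfun_inner_left]
        bounded_bilinear.continuous_on[OF bounded_bilinear_blinfun_compose] cont) auto
  have id: "id_blinfun o\<^sub>L \<Phi>' xbar = id_blinfun"
    by (rule blinfun_eqI) (simp add: apply_\<Phi>' g_def)
  have coordinate: "g i \<bullet> (\<Sum>j<m. a j *\<^sub>R e j) = a i" if "i < m" for i and a :: "nat \<Rightarrow> real"
  proof -
    have "g i \<bullet> (\<Sum>j<m. a j *\<^sub>R e j) = (\<Sum>j<m. if j = i then a j else 0)"
      unfolding inner_sum_right by (rule sum.cong) (use e that in auto)
    then show ?thesis using that by simp
  qed
  have straight: "g i \<bullet> \<Phi> y = F i y" if "i < m" for i y
    using that by (simp add: \<Phi>_def inner_add_right coordinate)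
  have straight': "g i \<bullet> \<Phi>' y h = G i y \<bullet> h" if "i < m" for i y h
    using that by (simp add: apply_\<Phi>' inner_add_right coordinate inner_diff_right inner_commute)
  obtain W V \<Psi> \<Psi>' where W: "open W" "W \<subseteq> U" "xbar \<in> W" and V: "open V"
    and hom: "homeomorphism W V \<Phi> \<Psi>"
    and der_\<Psi>: "\<And>z. z \<in> V \<Longrightarrow> (\<Psi> has_derivative \<Psi>' z) (at z)"
    and \<Psi>': "\<And>z. z \<in> V \<Longrightarrow> \<Psi>' z = inv (blinfun_apply (\<Phi>' (\<Psi> z)))"
    and bij: "\<And>z. z \<in> V \<Longrightarrow> bij (blinfun_apply (\<Phi>' (\<Psi> z)))"
    by (rule inverse_function_theorem[OF U(1) der_\<Phi> cont_\<Phi>' U(2) id]) (assumption | rule that)+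
  have "tangent_cone X x = {w. \<forall>i<m. G i x \<bullet> w = 0}" if x: "x \<in> X \<inter> W" for x
  proof
    have xU: "x \<in> U" "x \<in> X" using x W by auto
    have F0: "F i y = 0" if "i < m" "y \<in> X \<inter> U" for i y using X that by blast
    show "tangent_cone X x \<subseteq> {w. \<forall>i<m. G i x \<bullet> w = 0}"
    proof (intro subsetI CollectI allI impI)
      fix w i assume w: "w \<in> tangent_cone X x" and i: "i < m"
      have "G i x \<in> regular_normal_cone X x"
        by (rule gradient_in_regular_normal_cone[OF der[OF i xU(1)] U(1) xU(2) xU(1) F0[OF i]])
      moreover have "- G i x \<in> regular_normal_cone X x"
        using F0[OF i]
        by (intro gradient_in_regular_normal_cone[OF GDERIV_minus[OF der[OF i xU(1)]] U(1) xU(2) xU(1)])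
          simp
      ultimately show "G i x \<bullet> w = 0"
        using regular_normal_cone_polar[OF _ w, of "G i x"]
          regular_normal_cone_polar[OF _ w, of "- G i x"] by simp
    qed
    show "{w. \<forall>i<m. G i x \<bullet> w = 0} \<subseteq> tangent_cone X x"
    proof
      fix w assume w: "w \<in> {w. \<forall>i<m. G i x \<bullet> w = 0}"
      \<comment> \<open>The line through \<open>\<Phi> x\<close> in the direction of the image of \<open>w\<close> stays in the subspace, so its
        preimage is a curve in \<open>X\<close> with velocity \<open>w\<close>.\<close>
      define c where "c t = \<Phi> x + t *\<^sub>R \<Phi>' x w" for t :: real
      have c0: "c 0 = \<Phi> x" by (simp add: c_def)
      have \<Phi>x: "\<Phi> x \<in> V" "\<Psi> (\<Phi> x) = x"
        using hom x by (auto simp: homeomorphism_def)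
      have "(c has_derivative (\<lambda>t. t *\<^sub>R \<Phi>' x w)) (at 0)"
        unfolding c_def[abs_def] by (auto intro!: derivative_eq_intros)
      from has_derivative_compose[OF this, of \<Psi> "\<Psi>' (\<Phi> x)"]
      have "((\<lambda>t. \<Psi> (c t)) has_derivative (\<lambda>t. \<Psi>' (\<Phi> x) (t *\<^sub>R \<Phi>' x w))) (at 0)"
        using der_\<Psi>[OF \<Phi>x(1)] by (simp add: c0)
      moreover have "\<Psi>' (\<Phi> x) (t *\<^sub>R \<Phi>' x w) = t *\<^sub>R w" for t
      proof -
        have "\<Psi>' (\<Phi> x) (\<Phi>' x (t *\<^sub>R w)) = t *\<^sub>R w"
          using \<Psi>'[OF \<Phi>x(1)] bij[OF \<Phi>x(1)] \<Phi>x(2) by (simp add: bij_is_inj)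
        then show ?thesis by (simp add: blinfun.scaleR_right)
      qed
      ultimately have "((\<lambda>t. \<Psi> (c t)) has_vector_derivative w) (at 0)"
        by (simp add: has_vector_derivative_def)
      moreover have "\<forall>\<^sub>F t in at_right 0. \<Psi> (c t) \<in> X"
      proof -
        have "(c \<longlongrightarrow> c 0) (at_right 0)"
          unfolding c_def[abs_def] by (intro tendsto_intros)
        then have "\<forall>\<^sub>F t in at_right 0. c t \<in> V"
          using topological_tendstoD V \<Phi>x(1) c0 by metis
        then show ?thesis
        proof eventually_elim
          case (elim t)
          then have y: "\<Psi> (c t) \<in> W" "\<Phi> (\<Psi> (c t)) = c t"
            using hom by (auto simp: homeomorphism_def)
          have "F i (\<Psi> (c t)) = 0" if "i < m" for i
          proof -
            have "F i (\<Psi> (c t)) = g i \<bullet> c t" using straight[OF that, of "\<Psi> (c t)"] y(2) by simp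
            also have "\<dots> = F i x + t * (G i x \<bullet> w)"
              using that by (simp add: c_def inner_add_right straight straight')
            also have "\<dots> = 0" using F0[OF that] w that xU by simp
            finally show ?thesis .
          qed
          then show ?case using y(1) W(2) X by blast
        qed
      qed
      ultimately show "w \<in> tangent_cone X x"
        using curve_derivative_in_tangent_cone[of "\<lambda>t. \<Psi> (c t)" w X] c0 \<Phi>x(2) xU(2) by simp
    qed
  qed
  then show thesis using that W by blast
qed

section \<open>Normals of sets lying over a manifold\<close>

lemma regular_normal_cone_add_gradient:
  assumes C: "C \<subseteq> X \<times> UNIV" and U: "open U" "fst p \<in> U"
    and der: "GDERIV f (fst p) :> g" and zero: "\<And>y. y \<in> X \<inter> U \<Longrightarrow> f y = 0"
    and v: "v \<in> regular_normal_cone C p"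
  shows "v + c *\<^sub>R (g, 0) \<in> regular_normal_cone C p"
proof (rule regular_normal_cone_add[OF v])
  have p: "p \<in> C" using v by (simp add: mem_regular_normal_cone_iff)
  \<comment> \<open>The added vector is the gradient of \<open>c * f\<close> read on the product, which vanishes on \<open>C\<close>.\<close>
  have "((\<lambda>q. f (fst q)) has_derivative (\<lambda>h. fst h \<bullet> g)) (at p)"
    using has_derivative_compose[OF has_derivative_fst[OF has_derivative_ident], of f "\<lambda>h. h \<bullet> g" p UNIV]
      der by (simp add: gderiv_def)
  then have "GDERIV (\<lambda>q. c * f (fst q)) p :> c *\<^sub>R (g, 0)"
    unfolding gderiv_def
    by (rule has_derivative_eq_rhs[OF has_derivative_mult_right]) (auto simp: inner_prod_def)
  then show "c *\<^sub>R (g, 0) \<in> regular_normal_cone C p"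
  proof (rule gradient_in_regular_normal_cone)
    show "open (U \<times> UNIV)" using U by (simp add: open_Times)
  qed (use U p C zero in auto)
qed

text \<open>Along an approximating sequence the gradient is taken at the approximating points, where it
  preserves regular normality; continuity of \<open>G\<close> identifies the limit.\<close>

lemma normal_cone_add_gradient:
  assumes C: "C \<subseteq> X \<times> UNIV" and U: "open U" "fst p \<in> U"
    and der: "\<And>y. y \<in> U \<Longrightarrow> GDERIV f y :> G y" and cont: "continuous_on U G"
    and zero: "\<And>y. y \<in> X \<inter> U \<Longrightarrow> f y = 0"
    and v: "v \<in> normal_cone C p"
  shows "v + c *\<^sub>R (G (fst p), 0) \<in> normal_cone C p"
proof -
  have p: "p \<in> C" and "v \<in> outer_limit (regular_normal_cone C) C p"
    using v by (auto simp: normal_cone_def split: if_splits)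
  moreover have "open (U \<times> UNIV)" "p \<in> U \<times> UNIV" using U by (auto simp: open_Times mem_Times_iff)
  ultimately obtain q w where qw: "\<And>k. q k \<in> C" "\<And>k. q k \<in> U \<times> UNIV"
    "\<And>k::nat. w k \<in> regular_normal_cone C (q k)" "q \<longlonglongrightarrow> p" "w \<longlonglongrightarrow> v"
    using outer_limit_localE by metis
  have qU: "fst (q k) \<in> U" for k using qw(2)[of k] by (simp add: mem_Times_iff)
  have "w k + c *\<^sub>R (G (fst (q k)), 0) \<in> regular_normal_cone C (q k)" for k
    by (rule regular_normal_cone_add_gradient[OF C U(1) qU der[OF qU] zero qw(3)])
  moreover have "(\<lambda>k. G (fst (q k))) \<longlonglongrightarrow> G (fst p)"
    by (rule continuous_on_tendsto_compose[OF cont tendsto_fst[OF qw(4)]]) (use U qU in auto)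
  then have "(\<lambda>k. w k + c *\<^sub>R (G (fst (q k)), 0)) \<longlonglongrightarrow> v + c *\<^sub>R (G (fst p), 0)"
    by (intro tendsto_intros qw)
  ultimately have "v + c *\<^sub>R (G (fst p), 0) \<in> outer_limit (regular_normal_cone C) C p"
    using qw(1,4) by (intro outer_limitI[of q _ "\<lambda>k. w k + c *\<^sub>R (G (fst (q k)), 0)"])
  then show ?thesis using p by (simp add: normal_cone_def)
qed

section \<open>Projectional coderivatives on a smooth manifold\<close>

theorem proposition3p3:
  fixes S :: "real ^ 'n \<Rightarrow> (real ^ 'm) set"
    and X :: "(real ^ 'n) set"
    and xbar :: "real ^ 'n"
    and ubar :: "real ^ 'm"
    and d :: nat
  assumes "closed X"
    and "xbar \<in> X"
    and "ubar \<in> S xbar"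
    and "locally_closed_at (gph S) (xbar, ubar)"
    and "smooth_manifold_around d X xbar"
  shows "\<forall>\<^sub>F (x, u) in nhds (xbar, ubar). (x, u) \<in> gph (restrict_svm S X) \<longrightarrow>
      proj_set (tangent_cone X x \<times> UNIV) (regular_normal_cone (gph (restrict_svm S X)) (x, u))
        = regular_normal_cone (gph (restrict_svm S X)) (x, u) \<inter> (tangent_cone X x \<times> UNIV)
    \<and> proj_set (tangent_cone X x \<times> UNIV) (normal_cone (gph (restrict_svm S X)) (x, u))
        = normal_cone (gph (restrict_svm S X)) (x, u) \<inter> (tangent_cone X x \<times> UNIV)
    \<and> (\<forall>us. proj_coderivative X S x u us
              = proj_set (tangent_cone X x) (coderivative (restrict_svm S X) x u us)
          \<and> proj_set (tangent_cone X x) (coderivative (restrict_svm S X) x u us)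
              = coderivative (restrict_svm S X) x u us \<inter> tangent_cone X x)"
proof -
  let ?C = "gph (restrict_svm S X)"
  let ?m = "DIM(real ^ 'n) - d"
  obtain U F G where U: "open U" "xbar \<in> U"
    and FG: "\<forall>i<?m. (\<forall>y\<in>U. GDERIV (F i) y :> G i y) \<and> continuous_on U (G i)"
    and rank: "dim ((\<lambda>i. G i xbar) ` {..<?m}) = ?m"
    and X: "X \<inter> U = {y \<in> U. \<forall>i<?m. F i y = 0}"
    using assms(5) unfolding smooth_manifold_around_def by blast
  have der: "GDERIV (F i) y :> G i y" if "i < ?m" "y \<in> U" for i y using FG that by blast
  have cont: "continuous_on U (G i)" if "i < ?m" for i using FG that by blast
  have F0: "F i y = 0" if "i < ?m" "y \<in> X \<inter> U" for i y using X that by blast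
  obtain W where W: "open W" "xbar \<in> W" "W \<subseteq> U"
    and T: "\<And>x. x \<in> X \<inter> W \<Longrightarrow> tangent_cone X x = {w. \<forall>i<?m. G i x \<bullet> w = 0}"
    by (rule tangent_cone_eq_kernel_near[OF U der cont rank X]) (assumption | rule that)+
  have C: "?C \<subseteq> X \<times> UNIV" by (auto simp: gph_def restrict_svm_def split: if_splits)
  have open_W: "open (W \<times> (UNIV :: (real ^ 'm) set))" using W by (simp add: open_Times)

  \<comment> \<open>Padding the gradients with zeros turns the product of the tangent space with the whole space
    into an orthogonal complement, so that the projection lemma applies to it.\<close>
  define B where "B x = (\<lambda>i. (G i x, 0 :: real ^ 'm)) ` {..<?m}" for x
  have TB: "tangent_cone X x \<times> (UNIV :: (real ^ 'm) set) = {w. \<forall>b\<in>B x. b \<bullet> w = 0}" if "x \<in> X \<inter> W" for x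
    unfolding T[OF that] by (auto simp: B_def)
  have proj_regular: "proj_set (tangent_cone X (fst p) \<times> UNIV) (regular_normal_cone ?C p)
      = regular_normal_cone ?C p \<inter> (tangent_cone X (fst p) \<times> UNIV)"
    if p: "p \<in> ?C" "fst p \<in> W" for p
  proof -
    have x: "fst p \<in> X \<inter> W" "fst p \<in> U" using p C W by auto
    show ?thesis unfolding TB[OF x(1)]
    proof (rule proj_set_eq_Int_if_lineality)
      fix b v c assume "b \<in> B (fst p)" and v: "v \<in> regular_normal_cone ?C p"
      then obtain i where i: "i < ?m" "b = (G i (fst p), 0)" by (auto simp: B_def)
      show "v + c *\<^sub>R b \<in> regular_normal_cone ?C p" unfolding i(2)
        by (rule regular_normal_cone_add_gradient[OF C U(1) x(2) der[OF i(1) x(2)] F0[OF i(1)] v])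
    qed
  qed
  have shift: "v + c *\<^sub>R (G i (fst p), 0) \<in> normal_cone ?C p"
    if "fst p \<in> W" "v \<in> normal_cone ?C p" "i < ?m" for p v c i
    by (rule normal_cone_add_gradient[OF C U(1) _ der[OF that(3)] cont[OF that(3)] F0[OF that(3)] that(2)])
      (use that W in auto)
  have proj_normal: "proj_set (tangent_cone X (fst p) \<times> UNIV) (normal_cone ?C p)
      = normal_cone ?C p \<inter> (tangent_cone X (fst p) \<times> UNIV)"
    if p: "p \<in> ?C" "fst p \<in> W" for p
  proof -
    have x: "fst p \<in> X \<inter> W" using p C by auto
    show ?thesis unfolding TB[OF x]
      by (rule proj_set_eq_Int_if_lineality) (use shift[OF p(2)] in \<open>auto simp: B_def\<close>)
  qed
  have limit: "outer_limit
        (\<lambda>p. proj_set (tangent_cone X (fst p) \<times> UNIV) (normal_cone ?C p)) ?C p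
      = normal_cone ?C p \<inter> (tangent_cone X (fst p) \<times> UNIV)"
    if p: "p \<in> ?C" "fst p \<in> W" for p
  proof
    have x: "fst p \<in> X \<inter> W" using p C by auto
    show "outer_limit (\<lambda>p. proj_set (tangent_cone X (fst p) \<times> UNIV) (normal_cone ?C p)) ?C p
        \<subseteq> normal_cone ?C p \<inter> (tangent_cone X (fst p) \<times> UNIV)"
    proof
      fix v assume v: "v \<in> outer_limit
        (\<lambda>p. proj_set (tangent_cone X (fst p) \<times> UNIV) (normal_cone ?C p)) ?C p"
      have "p \<in> W \<times> UNIV" using p by (simp add: mem_Times_iff)
      from v open_W this obtain q w where q: "\<And>k. q k \<in> ?C" "\<And>k. q k \<in> W \<times> UNIV"
        and w: "\<And>k::nat. w k \<in> proj_set (tangent_cone X (fst (q k)) \<times> UNIV) (normal_cone ?C (q k))"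
        and lim: "q \<longlonglongrightarrow> p" "w \<longlonglongrightarrow> v"
        by (rule outer_limit_localE) (assumption | rule that)+
      have qW: "fst (q k) \<in> X \<inter> W" for k using q[of k] C by auto
      have w': "w k \<in> normal_cone ?C (q k)" "fst (w k) \<in> tangent_cone X (fst (q k))" for k
        using w[of k] proj_normal[OF q(1), of k] qW[of k] by (auto simp: mem_Times_iff)
      have "v \<in> outer_limit (normal_cone ?C) ?C p"
        by (rule outer_limitI[OF q(1) w'(1) lim])
      then have "v \<in> normal_cone ?C p" using outer_limit_normal_cone_subset[OF p(1)] by blast
      moreover have "G i (fst p) \<bullet> fst v = 0" if i: "i < ?m" for i
      proof -
        have "(\<lambda>k. G i (fst (q k))) \<longlonglongrightarrow> G i (fst p)"
          by (rule continuous_on_tendsto_compose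
              [OF continuous_on_subset[OF cont[OF i] W(3)] tendsto_fst[OF lim(1)]])
            (use x qW in auto)
        then have "(\<lambda>k. G i (fst (q k)) \<bullet> fst (w k)) \<longlonglongrightarrow> G i (fst p) \<bullet> fst v"
          by (intro tendsto_intros lim)
        moreover have "G i (fst (q k)) \<bullet> fst (w k) = 0" for k
          using w'(2)[of k] T[OF qW[of k]] i by blast
        ultimately show ?thesis by (simp add: LIMSEQ_const_iff)
      qed
      ultimately show "v \<in> normal_cone ?C p \<inter> (tangent_cone X (fst p) \<times> UNIV)"
        using T[OF x] by (simp add: mem_Times_iff)
    qed
    show "normal_cone ?C p \<inter> (tangent_cone X (fst p) \<times> UNIV) \<subseteq> outer_limit
        (\<lambda>p. proj_set (tangent_cone X (fst p) \<times> UNIV) (normal_cone ?C p)) ?C p"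
      unfolding proj_normal[OF p, symmetric] by (intro subsetI outer_limit_constI[OF p(1)])
  qed
  have coder: "proj_set (tangent_cone X x) (coderivative (restrict_svm S X) x u us)
      = coderivative (restrict_svm S X) x u us \<inter> tangent_cone X x"
    if xu: "(x, u) \<in> ?C" "x \<in> W" for x u us
  proof -
    have x: "x \<in> X \<inter> W" using xu C by auto
    have T': "tangent_cone X x = {w. \<forall>b\<in>(\<lambda>i. G i x) ` {..<?m}. b \<bullet> w = 0}"
      unfolding T[OF x] by auto
    show ?thesis unfolding T'
    proof (rule proj_set_eq_Int_if_lineality)
      fix b v c
      assume "b \<in> (\<lambda>i. G i x) ` {..<?m}" and v: "v \<in> coderivative (restrict_svm S X) x u us"
      then obtain i where i: "i < ?m" "b = G i x" by auto
      show "v + c *\<^sub>R b \<in> coderivative (restrict_svm S X) x u us"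
        using shift[of "(x, u)" "(v, - us)" i c] v i xu(2) by (simp add: coderivative_def)
    qed
  qed
  have proj_coder: "proj_coderivative X S x u us
      = coderivative (restrict_svm S X) x u us \<inter> tangent_cone X x"
    if xu: "(x, u) \<in> ?C" "x \<in> W" for x u us
    using limit[of "(x, u)"] xu by (auto simp: proj_coderivative_def coderivative_def)
  have "\<forall>\<^sub>F p in nhds (xbar, ubar). p \<in> W \<times> UNIV"
    using open_W W(2) by (intro eventually_nhds_in_open) auto
  then show ?thesis
  proof eventually_elim
    case (elim p)
    obtain x u where p: "p = (x, u)" by (cases p)
    then have "x \<in> W" using elim by simp
    then show ?case
      using proj_regular[of p] proj_normal[of p] coder[of x u] proj_coder[of x u] by (simp add: p)
  qed
qed

end
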